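(* Let $m$ be a positive integer, $n=2m$, $q=2^n$, and let $\mathbb{F}_q$ be the finite field with $q$ elements. For $x\in\mathbb{F}_q$ write $\overline{x}=x^{2^m}$. Define $$D=\{x\in \mathbb{F}_q^* : {\rm Tr}_{\mathbb{F}_{2^m}/\mathbb{F}_2}(x+\overline{x})={\rm Tr}_{\mathbb{F}_{2^m}/\mathbb{F}_2}(x\overline{x})=1\}.$$ Then the Cayley graph $\mathfrak{C}(\mathbb{F}_q,D)$ is a connected bipartite graph which has only five eigenvalues; its eigenvalues are: $\pm 2^{n-2}$ if $m$ is even, and $\pm(2^{n-2}+2^{m-1})$ if $m$ is odd, together with $0$ and $\pm 2^{m-1}$. As a consequence, $\mathfrak{C}(\mathbb{F}_q,D)$ is a Ramanujan graph.
   Context: ${\rm Tr}_{\mathbb{F}_{2^m}/\mathbb{F}_2}$ is the trace map; note that $x+\overline{x}$ and $x\overline{x}$ lie in $\mathbb{F}_{2^m}$. The Cayley graph $\mathfrak{C}(\mathbb{F}_q,D)$ has vertex set $\mathbb{F}_q$, and two vertices $u,v$ are adjacent if and only if $u-v\in D$. The eigenvalues of a graph are the eigenvalues of its adjacency matrix. A connected $k$-regular graph is called a Ramanujan graph if $\lambda\leq 2\sqrt{k-1}$ for all eigenvalues $\lambda$ of the graph with $|\lambda|\neq k$ (the first inequality is on $\lambda$ itself, as in the paper's definition).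
   Formalization: The five-eigenvalue list is asserted only for m at least 2; for m=1 the graph is the 4-cycle, where ±2^(m-1)=±1 are not eigenvalues, so there the true spectrum {2,-2,0} is stated; all other claims keep every positive m. *)

theory Defs
  imports Complex_Main "HOL-Library.Cardinality" "Graph_Theory.Digraph_Component" "Jordan_Normal_Form.Char_Poly"
begin

text \<open>The trace map from the field with \<open>2 ^ m\<close> elements to its prime field, as the sum of the
  Galois conjugates. It is written as a function on the ambient field of \<open>2 ^ (2 * m)\<close>
  elements, but is a trace only at arguments fixed by \<open>y \<mapsto> y ^ 2 ^ m\<close>;
  its values there are the elements 0 and 1 of the ambient field.\<close>

definition trace_F2 :: "nat \<Rightarrow> 'a::field \<Rightarrow> 'a" where
  "trace_F2 m y = (\<Sum>i<m. y ^ (2 ^ i))"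

definition bar :: "nat \<Rightarrow> 'a::field \<Rightarrow> 'a" where
  "bar m x = x ^ (2 ^ m)"

text \<open>An undirected graph is represented, as in the theory of digraphs imported here, by a symmetric
  arc relation; \<open>pair_graph G\<close> says that \<open>G\<close> is a finite simple undirected graph.\<close>

definition cayley_graph :: "'a::ab_group_add set \<Rightarrow> 'a pair_pre_digraph" where
  "cayley_graph D = \<lparr> pverts = UNIV, parcs = {(u, v). u - v \<in> D} \<rparr>"

definition bipartite :: "'a pair_pre_digraph \<Rightarrow> bool" where
  "bipartite G \<longleftrightarrow> (\<exists>X Y. X \<union> Y = pverts G \<and> X \<inter> Y = {} \<and>
     (\<forall>(u, v) \<in> parcs G. (u \<in> X \<and> v \<in> Y) \<or> (u \<in> Y \<and> v \<in> X)))"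

definition regular_graph :: "nat \<Rightarrow> 'a pair_pre_digraph \<Rightarrow> bool" where
  "regular_graph k G \<longleftrightarrow> (\<forall>v \<in> pverts G. out_degree (with_proj G) v = k)"

definition adjacency_matrix :: "'a pair_pre_digraph \<Rightarrow> 'a list \<Rightarrow> real mat" where
  "adjacency_matrix G vs =
     mat (length vs) (length vs) (\<lambda>(i, j). if (vs ! i, vs ! j) \<in> parcs G then 1 else 0)"

text \<open>Matrices are indexed by natural numbers, so an enumeration of the vertices is chosen.
  Different enumerations give permutation-similar matrices, hence the same eigenvalues. For an
  undirected graph the matrix is symmetric, so working over the reals loses no eigenvalue.\<close>

definition graph_eigenvalues :: "'a pair_pre_digraph \<Rightarrow> real set" where
  "graph_eigenvalues G =
     {l. \<exists>vs. distinct vs \<and> set vs = pverts G \<and> eigenvalue (adjacency_matrix G vs) l}"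

text \<open>The inequality bounds the eigenvalue itself, not its absolute value.\<close>

definition ramanujan_graph :: "'a pair_pre_digraph \<Rightarrow> bool" where
  "ramanujan_graph G \<longleftrightarrow> pair_graph G \<and> Digraph_Component.connected (with_proj G) \<and>
     (\<exists>k. regular_graph k G \<and>
       (\<forall>l \<in> graph_eigenvalues G. \<bar>l\<bar> \<noteq> real k \<longrightarrow> l \<le> 2 * sqrt (real k - 1)))"

end

theory Submission
  imports Defs
begin

text \<open>Let \<open>chi x\<close> and \<open>psi x\<close> be the signs of the traces of \<open>x + bar x\<close> and \<open>x * bar x\<close>. The characters
  \<open>x \<mapsto> chi (a * x)\<close> diagonalise the adjacency matrix, and the indicator function of \<open>D\<close> is
  \<open>(1 - chi x) * (1 - psi x) / 4\<close>, so the eigenvalues reduce to the sums of \<open>psi x * chi (a * x)\<close>.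
  Completing the square evaluates these as \<open>psi a\<close> times the sum of \<open>psi\<close>, which is \<open>- (2 ^ m)\<close>
  because the norm is \<open>2 ^ m + 1\<close> to one on nonzero elements. The degree is an eigenvalue for the
  trivial character only, whence connectedness; the sign \<open>chi\<close> gives the bipartition.\<close>

section \<open>Cayley graphs of finite abelian groups\<close>

lemma sum_Cayley_neighbours:
  fixes v :: "'a::{ab_group_add,finite} \<Rightarrow> real"
  shows "(\<Sum>y\<in>UNIV. if x - y \<in> D then v y else 0) = (\<Sum>d\<in>D. v (x - d))"
proof -
  have "(\<Sum>y\<in>UNIV. if x - y \<in> D then v y else 0) = (\<Sum>y\<in>{y. x - y \<in> D}. v y)"
    by (simp add: sum.If_cases)
  also have "\<dots> = (\<Sum>d\<in>D. v (x - d))"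
    by (rule sum.reindex_bij_witness[of _ "\<lambda>d. x - d" "\<lambda>y. x - y"]) auto
  finally show ?thesis .
qed

text \<open>An enumeration of the group identifies vectors with functions on it and turns the
  adjacency matrix into convolution with the indicator of \<open>D\<close>. After this no argument
  depends on matrices or on the enumeration.\<close>

lemma graph_eigenvalues_cayley_graph:
  fixes D :: "'a::{ab_group_add,finite} set"
  shows "l \<in> graph_eigenvalues (cayley_graph D) \<longleftrightarrow>
    (\<exists>v::'a \<Rightarrow> real. (\<exists>x. v x \<noteq> 0) \<and> (\<forall>x. (\<Sum>d\<in>D. v (x - d)) = l * v x))"
    (is "?L \<longleftrightarrow> ?R")
proof -
  have mult: "(adjacency_matrix (cayley_graph D) vs *\<^sub>v vec (length vs) (\<lambda>i. v (vs ! i))) $ i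
      = (\<Sum>d\<in>D. v (vs ! i - d))"
    if vs: "distinct vs" "set vs = UNIV" and i: "i < length vs" for vs v i
  proof -
    have "(adjacency_matrix (cayley_graph D) vs *\<^sub>v vec (length vs) (\<lambda>i. v (vs ! i))) $ i
        = (\<Sum>j<length vs. if vs ! i - vs ! j \<in> D then v (vs ! j) else 0)"
      using i by (auto simp: adjacency_matrix_def cayley_graph_def scalar_prod_def
          lessThan_atLeast0 intro!: sum.cong)
    also have "\<dots> = (\<Sum>y\<in>UNIV. if vs ! i - y \<in> D then v y else 0)"
      by (rule sum.reindex_bij_betw[OF bij_betw_nth]) (use vs in auto)
    finally show ?thesis by (simp add: sum_Cayley_neighbours)
  qed
  show ?thesis
  proof
    assume ?L
    then obtain vs w where vs: "distinct vs" "set vs = (UNIV::'a set)"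
      and w: "eigenvector (adjacency_matrix (cayley_graph D) vs) w l"
      by (auto simp: graph_eigenvalues_def eigenvalue_def cayley_graph_def)
    let ?N = "length vs"
    have dim: "dim_row (adjacency_matrix (cayley_graph D) vs) = ?N"
      by (simp add: adjacency_matrix_def)
    have w: "w \<in> carrier_vec ?N" "w \<noteq> 0\<^sub>v ?N"
      "adjacency_matrix (cayley_graph D) vs *\<^sub>v w = l \<cdot>\<^sub>v w"
      using w unfolding eigenvector_def dim by auto
    have bij: "bij_betw (nth vs) {..<?N} UNIV"
      by (rule bij_betw_nth) (use vs in auto)
    define v where "v x = w $ the_inv_into {..<?N} (nth vs) x" for x
    have v_nth: "v (vs ! i) = w $ i" if "i < ?N" for i
      using that bij by (simp add: v_def the_inv_into_f_f bij_betw_def)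
    have w_eq: "w = vec ?N (\<lambda>i. v (vs ! i))"
      using w(1) by (intro eq_vecI) (auto simp: v_nth)
    have "\<exists>i<?N. w $ i \<noteq> 0"
    proof (rule ccontr)
      assume "\<not> (\<exists>i<?N. w $ i \<noteq> 0)"
      then have "w = 0\<^sub>v ?N" using w(1) by (intro eq_vecI) auto
      with w(2) show False by simp
    qed
    then have "\<exists>x. v x \<noteq> 0" using v_nth by metis
    moreover have "(\<Sum>d\<in>D. v (x - d)) = l * v x" for x
    proof -
      obtain i where i: "i < ?N" "x = vs ! i"
        using vs(2) by (metis UNIV_I in_set_conv_nth)
      have "(\<Sum>d\<in>D. v (x - d)) = (adjacency_matrix (cayley_graph D) vs *\<^sub>v w) $ i"
        using mult[OF vs i(1), of v] i w_eq by simp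
      also have "\<dots> = l * v x" using i w v_nth by simp
      finally show ?thesis .
    qed
    ultimately show ?R by blast
  next
    assume ?R
    then obtain v :: "'a \<Rightarrow> real" and x0 where v: "v x0 \<noteq> 0"
      "\<And>x. (\<Sum>d\<in>D. v (x - d)) = l * v x"
      by blast
    obtain vs where vs: "set vs = (UNIV::'a set)" "distinct vs"
      using finite_distinct_list[OF finite_class.finite_UNIV] by blast
    let ?w = "vec (length vs) (\<lambda>i. v (vs ! i))"
    obtain i0 where i0: "i0 < length vs" "vs ! i0 = x0"
      using vs(1) by (metis UNIV_I in_set_conv_nth)
    have "?w \<noteq> 0\<^sub>v (length vs)"
    proof
      assume "?w = 0\<^sub>v (length vs)"
      then have "?w $ i0 = 0\<^sub>v (length vs) $ i0" by simp
      with i0 v(1) show False by simp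
    qed
    moreover have "adjacency_matrix (cayley_graph D) vs *\<^sub>v ?w = l \<cdot>\<^sub>v ?w"
    proof (rule eq_vecI)
      show "(adjacency_matrix (cayley_graph D) vs *\<^sub>v ?w) $ i = (l \<cdot>\<^sub>v ?w) $ i"
        if "i < dim_vec (l \<cdot>\<^sub>v ?w)" for i
        using that mult[OF vs(2,1), of i v] v(2) by simp
    qed (simp add: adjacency_matrix_def)
    ultimately have "eigenvalue (adjacency_matrix (cayley_graph D) vs) l"
      unfolding eigenvalue_def eigenvector_def
      by (intro exI[of _ ?w]) (simp add: adjacency_matrix_def)
    with vs show ?L by (auto simp: graph_eigenvalues_def cayley_graph_def)
  qed
qed

lemma pair_graph_cayley_graph:
  fixes D :: "'a::{ab_group_add,finite} set"
  assumes "0 \<notin> D" and "\<And>d. d \<in> D \<Longrightarrow> - d \<in> D"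
  shows "pair_graph (cayley_graph D)"
proof
  have "y - x \<in> D" if "x - y \<in> D" for x y
    using assms(2)[OF that] by simp
  then show "symmetric (with_proj (cayley_graph D))"
    by (auto simp: symmetric_def cayley_graph_def sym_def)
qed (use assms(1) in \<open>auto simp: cayley_graph_def\<close>)

lemma regular_graph_cayley_graph:
  "regular_graph (card D) (cayley_graph D)"
proof -
  have "bij_betw (\<lambda>d. (v, v - d)) D (out_arcs (with_proj (cayley_graph D)) v)" for v :: 'a
    by (rule bij_betwI[where g = "\<lambda>e. fst e - snd e"]) (auto simp: out_arcs_def cayley_graph_def)
  then show ?thesis
    by (metis regular_graph_def out_degree_def bij_betw_same_card)
qed

text \<open>Reachability from \<open>u\<close> is constant along arcs because \<open>D\<close> is
  symmetric, so its indicator is an eigenfunction for the degree. If all such functions are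
  constant, its value 1 at \<open>u\<close> spreads to every vertex.\<close>

lemma connected_cayley_graphI:
  fixes D :: "'a::{ab_group_add,finite} set"
  assumes sym: "0 \<notin> D" "\<And>d. d \<in> D \<Longrightarrow> - d \<in> D"
    and harmonic: "\<And>v::'a \<Rightarrow> real. (\<And>x. (\<Sum>d\<in>D. v (x - d)) = card D * v x)
      \<Longrightarrow> (\<And>x y. v x = v y)"
  shows "Digraph_Component.connected (with_proj (cayley_graph D))"
proof -
  interpret pair_graph "cayley_graph D"
    by (rule pair_graph_cayley_graph[OF sym])
  have arc: "(x, y) \<in> parcs (cayley_graph D)" if "x - y \<in> D" for x y
    using that by (simp add: cayley_graph_def)
  have "u \<rightarrow>\<^sup>*\<^bsub>with_proj (cayley_graph D)\<^esub> w" for u w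
  proof -
    define v :: "'a \<Rightarrow> real"
      where "v x = of_bool (u \<rightarrow>\<^sup>*\<^bsub>with_proj (cayley_graph D)\<^esub> x)" for x
    have "v (x - d) = v x" if "d \<in> D" for x d
    proof -
      have "x \<rightarrow>\<^bsub>with_proj (cayley_graph D)\<^esub> (x - d)" "(x - d) \<rightarrow>\<^bsub>with_proj (cayley_graph D)\<^esub> x"
        using arc[of x "x - d"] arc[of "x - d" x] that sym(2) by simp_all
      then show ?thesis
        using reachable_adj_trans by (auto simp: v_def of_bool_def)
    qed
    then have "(\<Sum>d\<in>D. v (x - d)) = card D * v x" for x by simp
    from harmonic[OF this, of w u] have "v w = v u" .
    moreover have "u \<in> pverts (cayley_graph D)" by (simp add: cayley_graph_def)
    then have "v u = 1" by (simp add: v_def)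
    ultimately show ?thesis by (simp add: v_def split: if_splits)
  qed
  then show ?thesis
    by (intro connectedI reachable_mk_symmetricI) (auto simp: cayley_graph_def)
qed

section \<open>Characters and the Hermitian form in characteristic two\<close>

text \<open>The values of a trace to the prime field are the elements 0 and 1 of the ambient field,
  hence this is the character \<open>y \<mapsto> (- 1) ^ y\<close> there.\<close>

definition sgn_F2 :: "'a::field \<Rightarrow> real" where
  "sgn_F2 y = (if y = 0 then 1 else - 1)"

text \<open>Keeping the leading term apart makes the degree immediate in all uses: zeros of the
  trace, fixed points of \<open>bar\<close> and fibres of the norm.\<close>

lemma card_roots_monic_le:
  fixes p :: "'a::field poly"
  assumes "degree p < k"
  shows "card {x. x ^ k = poly p x} \<le> k"
proof -
  let ?P = "monom 1 k - p"
  have deg: "degree ?P = k"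
    using assms degree_add_eq_left[of "- p" "monom 1 k"] by (simp add: degree_monom_eq)
  then have "?P \<noteq> 0" using assms by auto
  then have "card {x. poly ?P x = 0} \<le> degree ?P" by (rule card_poly_roots_bound)
  then show ?thesis by (simp add: deg poly_monom)
qed

text \<open>Multiplication by a nonzero \<open>x\<close> permutes the nonzero elements; comparing
  their products cancels to \<open>x ^ (CARD('a) - 1) = 1\<close>.\<close>

lemma power_card_eq:
  fixes x :: "'a::{field,finite}"
  shows "x ^ CARD('a) = x"
proof (cases "x = 0")
  case True
  then show ?thesis by (simp add: zero_power)
next
  case False
  have "(\<Prod>y\<in>UNIV - {0}. x * y) = (\<Prod>y\<in>UNIV - {0}. y)"
    by (rule prod.reindex_bij_witness[of _ "\<lambda>y. y / x" "\<lambda>y. x * y"]) (use False in auto)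
  then have "x ^ (CARD('a) - 1) = 1"
    by (simp add: prod.distrib card_Diff_singleton)
  then have "x * x ^ (CARD('a) - 1) = x" by simp
  then show ?thesis
    by (metis power_eq_if card_gt_0_iff finite_class.finite_UNIV UNIV_not_empty not_gr0)
qed

section \<open>Frobenius, conjugation and trace\<close>

locale quadratic_field_F2 =
  fixes m :: nat and dummy :: "'a::{field,finite} itself"
  assumes m_pos: "m > 0" and card_field: "CARD('a) = 2 ^ (2 * m)"
begin

text \<open>Translation by 1 permutes the field, so comparing sums makes the order of the field
  vanish in it, and this order is a power of 2.\<close>

lemma two_eq_0: "(2::'a) = 0"
proof -
  have "(\<Sum>x\<in>UNIV. x + (1::'a)) = (\<Sum>x\<in>UNIV. x)"
    by (rule sum.reindex_bij_witness[of _ "\<lambda>x. x - 1" "\<lambda>x. x + 1"]) auto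
  then have "of_nat CARD('a) = (0::'a)" by (simp add: sum.distrib)
  then show ?thesis by (simp add: card_field)
qed

lemma add_self: "(x::'a) + x = 0"
  using two_eq_0 by (metis mult_2 mult_zero_left)

lemma uminus_eq: "- (x::'a) = x"
  using add_self by (simp add: neg_eq_iff_add_eq_0)

lemma minus_eq_plus: "(x::'a) - y = x + y"
  by (metis uminus_eq diff_conv_add_uminus)

lemma add_power_2_power: "((x::'a) + y) ^ (2 ^ i) = x ^ (2 ^ i) + y ^ (2 ^ i)"
proof (induction i)
  case (Suc i)
  have "(x + y) ^ (2 ^ Suc i) = ((x + y) ^ (2 ^ i)) ^ 2"
    by (simp add: power_mult[symmetric] mult.commute)
  also have "\<dots> = (x ^ (2 ^ i)) ^ 2 + (y ^ (2 ^ i)) ^ 2"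
    by (simp add: Suc power2_sum two_eq_0)
  finally show ?case
    by (simp add: power_mult[symmetric] mult.commute)
qed simp

lemma bar_bar: "bar m (bar m x) = (x::'a)"
  using power_card_eq[of x]
  by (simp add: bar_def power_mult[symmetric] power_add[symmetric] card_field mult_2)

lemma bar_add: "bar m ((x::'a) + y) = bar m x + bar m y"
  by (simp add: bar_def add_power_2_power)

lemma bar_mult: "bar m ((x::'a) * y) = bar m x * bar m y"
  by (simp add: bar_def power_mult_distrib)

lemma bar_0: "bar m (0::'a) = 0"
  by (simp add: bar_def)

lemma bar_1: "bar m (1::'a) = 1"
  by (simp add: bar_def)

lemma bar_eq_0_iff: "bar m (x::'a) = 0 \<longleftrightarrow> x = 0"
  by (simp add: bar_def)

lemma trace_add: "trace_F2 m ((x::'a) + y) = trace_F2 m x + trace_F2 m y"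
  by (simp add: trace_F2_def add_power_2_power sum.distrib)

lemma trace_0: "trace_F2 m (0::'a) = 0"
  by (simp add: trace_F2_def zero_power)

text \<open>Squaring shifts the summands by one index, and the new last term
  \<open>y ^ (2 ^ m)\<close> is the lost first term \<open>y\<close>. Being idempotent, the trace is
  0 or 1.\<close>

lemma trace_square:
  assumes "bar m y = (y::'a)"
  shows "(trace_F2 m y) ^ 2 = trace_F2 m y"
proof -
  have sq: "(\<Sum>i\<in>A. f i) ^ 2 = (\<Sum>i\<in>A. f i ^ 2)" if "finite A" for f :: "nat \<Rightarrow> 'a" and A
    using that by induction (simp_all add: power2_sum two_eq_0)
  have "(trace_F2 m y) ^ 2 = (\<Sum>i<m. y ^ (2 ^ Suc i))"
    by (simp add: trace_F2_def sq power_mult[symmetric] mult.commute)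
  also have "\<dots> = (\<Sum>i<Suc m. y ^ (2 ^ i)) - y"
    by (subst sum.lessThan_Suc_shift) simp
  also have "\<dots> = trace_F2 m y"
    using assms by (simp add: trace_F2_def bar_def)
  finally show ?thesis .
qed

lemma trace_F2_cases:
  assumes "bar m y = (y::'a)"
  obtains "trace_F2 m y = 0" | "trace_F2 m y = 1"
  using trace_square[OF assms] by (metis power2_eq_square mult_cancel_right1)

lemma sgn_trace_add:
  assumes "bar m x = (x::'a)" and "bar m y = y"
  shows "sgn_F2 (trace_F2 m (x + y)) = sgn_F2 (trace_F2 m x) * sgn_F2 (trace_F2 m y)"
  using assms(1)
  by (cases rule: trace_F2_cases; use assms(2) in \<open>cases rule: trace_F2_cases\<close>)
     (simp_all add: trace_add sgn_F2_def two_eq_0)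

section \<open>The additive character and the sign of the norm form\<close>

definition chi :: "'a \<Rightarrow> real" where
  "chi x = sgn_F2 (trace_F2 m (x + bar m x))"

definition psi :: "'a \<Rightarrow> real" where
  "psi x = sgn_F2 (trace_F2 m (x * bar m x))"

lemma bar_add_bar: "bar m (x + bar m x) = x + bar m (x::'a)"
  by (simp add: bar_add bar_bar add.commute)

lemma bar_mult_bar: "bar m (x * bar m x) = x * bar m (x::'a)"
  by (simp add: bar_mult bar_bar mult.commute)

lemma chi_add: "chi (x + y) = chi x * chi y"
proof -
  have "x + y + bar m (x + y) = (x + bar m x) + (y + bar m y)"
    by (simp add: bar_add)
  then show ?thesis
    by (simp only: chi_def sgn_trace_add[OF bar_add_bar bar_add_bar])
qed

lemma chi_0: "chi 0 = 1"
  by (simp add: chi_def sgn_F2_def bar_0 trace_0)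

lemma chi_1: "chi 1 = 1"
  by (simp add: chi_def sgn_F2_def bar_1 two_eq_0 trace_0)

lemma chi_cases: obtains "chi x = 1" | "chi x = - 1"
  by (cases "chi x = 1") (auto simp: chi_def sgn_F2_def split: if_splits)

lemma psi_cases: obtains "psi x = 1" | "psi x = - 1"
  by (cases "psi x = 1") (auto simp: psi_def sgn_F2_def split: if_splits)

lemma psi_square: "psi x * psi x = 1"
  by (simp add: psi_def sgn_F2_def)

text \<open>Polarisation of the norm: the cross terms \<open>x * bar m y\<close> and
  \<open>y * bar m x\<close> are conjugate, so they contribute a value of \<open>chi\<close>. Hence
  \<open>psi\<close> is a quadratic character.\<close>

lemma psi_add: "psi (x + y) = psi x * psi y * chi (x * bar m y)"
proof -
  let ?z = "x * bar m y"
  have eq: "(x + y) * bar m (x + y) = (x * bar m x + y * bar m y) + (?z + bar m ?z)"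
    by (simp add: bar_add bar_mult bar_bar algebra_simps)
  have "bar m (x * bar m x + y * bar m y) = x * bar m x + y * bar m y"
    by (simp add: bar_add bar_mult_bar)
  then show ?thesis
    unfolding psi_def chi_def eq
    by (simp add: sgn_trace_add bar_add_bar bar_mult_bar)
qed

text \<open>The trace of 1 is a sum of \<open>m\<close> ones, which in characteristic two records
  the parity of \<open>m\<close>.\<close>

lemma psi_1: "psi 1 = (- 1) ^ m"
proof -
  have "even m \<longleftrightarrow> of_nat m = (0::'a)"
  proof
    assume "even m"
    then show "of_nat m = (0::'a)" by (auto simp: two_eq_0)
  next
    assume "of_nat m = (0::'a)"
    moreover have "of_nat (2 * k + 1) \<noteq> (0::'a)" for k by (simp add: two_eq_0)
    ultimately show "even m" by (metis oddE)
  qed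
  then show ?thesis
    by (auto simp: psi_def sgn_F2_def bar_1 trace_F2_def)
qed

text \<open>The trace to the prime field is a polynomial of degree less than the order of the field.\<close>

lemma chi_nontrivial: obtains x where "chi x = - 1"
proof -
  let ?k = "2 ^ (2 * m - 1) :: nat"
  let ?p = "\<Sum>i<2 * m - 1. monom (1::'a) (2 ^ i)"
  have split: "(\<Sum>i<m + k. f i) = (\<Sum>i<m. f i) + (\<Sum>i<k. f (m + i))" for f :: "nat \<Rightarrow> 'a" and k
    by (induction k) (simp_all add: add.assoc)
  \<comment> \<open>The trace to the prime field sums all \<open>2 * m\<close> conjugates of
    \<open>x\<close>; the highest is split off as the monic leading term.\<close>
  have tr: "trace_F2 m (x + bar m x) = x ^ ?k + poly ?p x" for x :: 'a
  proof -
    have "trace_F2 m (x + bar m x) = (\<Sum>i<m. x ^ (2 ^ i)) + (\<Sum>i<m. x ^ (2 ^ (m + i)))"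
      by (simp add: trace_F2_def add_power_2_power sum.distrib bar_def power_mult[symmetric]
          power_add[symmetric])
    also have "\<dots> = (\<Sum>i<m + m. x ^ (2 ^ i))"
      by (simp only: split)
    also have "\<dots> = (\<Sum>i<Suc (2 * m - 1). x ^ (2 ^ i))"
      using m_pos by (simp add: mult_2)
    finally show ?thesis
      by (simp add: poly_sum poly_monom add.commute)
  qed
  have "degree ?p \<le> 2 ^ (2 * m - 2)"
    by (intro degree_sum_le) (auto simp: degree_monom_eq intro!: power_increasing)
  also have "\<dots> < ?k"
    using m_pos by (intro power_strict_increasing) auto
  finally have "card {x. x ^ ?k = poly ?p x} \<le> ?k"
    by (rule card_roots_monic_le)
  also have "?k < 2 ^ (2 * m)"
    using m_pos by (intro power_strict_increasing) auto
  finally have "{x. x ^ ?k = poly ?p x} \<noteq> UNIV"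
    using card_field by auto
  then obtain x where "x ^ ?k \<noteq> poly ?p x" by blast
  then have "trace_F2 m (x + bar m x) \<noteq> 0"
    using tr[of x] by (metis add_self add_right_cancel)
  then show ?thesis
    by (intro that[of x]) (simp add: chi_def sgn_F2_def)
qed

section \<open>Evaluation of the character sums\<close>

text \<open>Orthogonality of characters: for \<open>a \<noteq> 0\<close>, translating by
  \<open>x0 / a\<close> with \<open>chi x0 = - 1\<close> negates the sum.\<close>

lemma sum_chi_mult: "(\<Sum>x\<in>UNIV. chi (a * x)) = (if a = 0 then 2 ^ (2 * m) else 0)"
proof (cases "a = 0")
  case True
  then show ?thesis by (simp add: chi_0 card_field)
next
  case False
  obtain x0 where x0: "chi x0 = - 1" by (rule chi_nontrivial)
  have "(\<Sum>x\<in>UNIV. chi (a * x)) = (\<Sum>x\<in>UNIV. chi (a * x + x0))"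
    by (rule sum.reindex_bij_witness[of _ "\<lambda>x. x + x0 / a" "\<lambda>x. x - x0 / a"])
       (use False in \<open>auto simp: algebra_simps\<close>)
  also have "\<dots> = - (\<Sum>x\<in>UNIV. chi (a * x))"
    by (simp add: chi_add x0 sum_negf)
  finally show ?thesis using False by simp
qed

text \<open>All fibres of the norm have at most \<open>2 ^ m + 1\<close> elements and there are at most \<open>2 ^ m - 1\<close>
  of them, but together they exhaust the \<open>(2 ^ m - 1) * (2 ^ m + 1)\<close> nonzero elements.\<close>

lemma card_norm_fibre:
  assumes "bar m c = (c::'a)" and "c \<noteq> 0"
  shows "card {x. x * bar m x = c} = 2 ^ m + 1"
proof -
  let ?K = "{c::'a. bar m c = c \<and> c \<noteq> 0}"
  let ?fib = "\<lambda>c::'a. {x. x * bar m x = c}"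
  have fib_le: "card (?fib c) \<le> 2 ^ m + 1" for c
    using card_roots_monic_le[of "[:c:]" "2 ^ m + 1"] by (simp add: bar_def)
  \<comment> \<open>Zero is itself a fixed point of \<open>bar\<close>, so the root bound
    \<open>2 ^ m\<close> leaves at most \<open>2 ^ m - 1\<close> possible nonzero norms.\<close>
  have "insert 0 ?K = {x. x ^ 2 ^ m = poly [:0, 1:] x}"
    by (auto simp: bar_def)
  moreover have "card {x::'a. x ^ 2 ^ m = poly [:0, 1:] x} \<le> 2 ^ m"
    using m_pos one_less_power[of "2::nat" m] by (intro card_roots_monic_le) simp
  ultimately have "card (insert 0 ?K) \<le> 2 ^ m" by simp
  then have K_le: "real (card ?K) \<le> 2 ^ m - 1"
    by (simp add: of_nat_le_iff[where 'a=real, symmetric] del: of_nat_le_iff)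
  have "(\<Sum>c\<in>?K. card (?fib c)) = card (\<Union>c\<in>?K. ?fib c)"
    by (rule card_UN_disjoint[symmetric]) auto
  also have "(\<Union>c\<in>?K. ?fib c) = UNIV - {0}"
    by (auto simp: bar_mult_bar bar_eq_0_iff)
  finally have total: "(\<Sum>c\<in>?K. real (card (?fib c))) = 2 ^ (2 * m) - 1"
    by (simp add: card_Diff_singleton card_field of_nat_diff flip: of_nat_sum)
  \<comment> \<open>The deficits of the fibres are nonnegative and their sum is at most zero, so
    each of them vanishes.\<close>
  have "(\<Sum>c\<in>?K. 2 ^ m + 1 - real (card (?fib c))) = real (card ?K) * (2 ^ m + 1) - (2 ^ (2 * m) - 1)"
    by (simp only: sum_subtractf total sum_constant)
  also have "\<dots> \<le> (2 ^ m - 1) * (2 ^ m + 1) - (2 ^ (2 * m) - 1)"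
    by (intro diff_right_mono mult_right_mono K_le) simp
  also have "\<dots> = 0"
    by (simp add: algebra_simps power_add[symmetric] mult_2)
  finally have le: "(\<Sum>c\<in>?K. 2 ^ m + 1 - real (card (?fib c))) \<le> 0" .
  have nn: "0 \<le> 2 ^ m + 1 - real (card (?fib c))" for c
    using fib_le[of c] by (simp add: of_nat_le_iff[where 'a=real, symmetric] del: of_nat_le_iff)
  have "(\<Sum>c\<in>?K. 2 ^ m + 1 - real (card (?fib c))) = 0"
    by (intro antisym le sum_nonneg nn)
  then have "2 ^ m + 1 - real (card (?fib c)) = 0"
    using sum_nonneg_eq_0_iff[of ?K "\<lambda>c. 2 ^ m + 1 - real (card (?fib c))"] nn assms by auto
  then have "real (card (?fib c)) = real (2 ^ m + 1)" by simp
  then show ?thesis by (simp only: of_nat_eq_iff)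
qed

text \<open>Translation by \<open>x0 + bar m x0\<close>, a subfield element of trace 1, negates
  every sign.\<close>

lemma sum_sgn_trace_subfield: "(\<Sum>c\<in>{c::'a. bar m c = c}. sgn_F2 (trace_F2 m c)) = 0"
proof -
  let ?K = "{c::'a. bar m c = c}"
  obtain x0 where x0: "chi x0 = - 1" by (rule chi_nontrivial)
  let ?t = "x0 + bar m x0"
  have cancel: "c + ?t + ?t = c" for c
    by (metis add.assoc add_self add_0_right)
  have "(\<Sum>c\<in>?K. sgn_F2 (trace_F2 m c)) = (\<Sum>c\<in>?K. sgn_F2 (trace_F2 m (c + ?t)))"
    by (rule sum.reindex_bij_witness[of _ "\<lambda>c. c + ?t" "\<lambda>c. c + ?t"])
       (simp_all only: cancel mem_Collect_eq bar_add[of _ ?t] bar_add_bar)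
  also have "\<dots> = (\<Sum>c\<in>?K. - sgn_F2 (trace_F2 m c))"
    using x0 by (intro sum.cong) (auto simp: sgn_trace_add bar_add_bar chi_def)
  finally show ?thesis by (simp add: sum_negf)
qed

text \<open>Grouping by the norm gives weight 1 to the fibre over 0 and \<open>2 ^ m + 1\<close> to
  each other fibre. The signs of the nonzero subfield elements sum to -1, which leaves
  \<open>1 - (2 ^ m + 1)\<close>.\<close>

lemma sum_psi: "(\<Sum>x\<in>UNIV. psi x) = - (2 ^ m)"
proof -
  let ?K = "{c::'a. bar m c = c}"
  have K: "?K = insert 0 (?K - {0})" by (auto simp: bar_eq_0_iff)
  have fib0: "{x. x * bar m x = 0} = {0::'a}" by (auto simp: bar_eq_0_iff)
  have "(\<Sum>x\<in>UNIV. psi x) = (\<Sum>c\<in>?K. \<Sum>x\<in>{x\<in>UNIV. x * bar m x = c}. psi x)"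
    by (rule sum.group[symmetric]) (auto simp: bar_mult_bar)
  also have "\<dots> = (\<Sum>c\<in>?K. card {x. x * bar m x = c} * sgn_F2 (trace_F2 m c))"
    by (intro sum.cong) (auto simp: psi_def)
  also have "\<dots> = 1 + (\<Sum>c\<in>?K - {0}. card {x. x * bar m x = c} * sgn_F2 (trace_F2 m c))"
    by (subst K, subst sum.insert) (auto simp: fib0 trace_0 sgn_F2_def simp del: mult_eq_0_iff)
  also have "(\<Sum>c\<in>?K - {0}. card {x. x * bar m x = c} * sgn_F2 (trace_F2 m c))
      = (2 ^ m + 1) * (\<Sum>c\<in>?K - {0}. sgn_F2 (trace_F2 m c))"
    unfolding sum_distrib_left by (intro sum.cong) (auto simp: card_norm_fibre)
  also have "(\<Sum>c\<in>?K - {0}. sgn_F2 (trace_F2 m c)) = - 1"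
    using sum_sgn_trace_subfield by (subst (asm) K, subst (asm) sum.insert) (auto simp: trace_0 sgn_F2_def)
  finally show ?thesis by simp
qed

text \<open>Polarising at \<open>bar m a\<close> completes the square:
  \<open>psi x * chi (a * x) = psi (x + bar m a) * psi a\<close>, and the shift disappears in the
  sum.\<close>

lemma sum_psi_chi: "(\<Sum>x\<in>UNIV. psi x * chi (a * x)) = - (2 ^ m) * psi a"
proof -
  have psi_bar: "psi (bar m a) = psi a"
    by (simp add: psi_def bar_bar mult.commute)
  have "(\<Sum>x\<in>UNIV. psi x * chi (a * x)) = (\<Sum>x\<in>UNIV. psi (x + bar m a) * psi a)"
    by (intro sum.cong refl)
       (simp add: psi_add bar_bar psi_bar mult.commute[of a] mult.assoc psi_square
         mult.left_commute[of "psi a"])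
  also have "\<dots> = (\<Sum>x\<in>UNIV. psi (x + bar m a)) * psi a"
    by (simp add: sum_distrib_right)
  also have "(\<Sum>x\<in>UNIV. psi (x + bar m a)) = (\<Sum>x\<in>UNIV. psi x)"
    by (rule sum.reindex_bij_witness[of _ "\<lambda>x. x - bar m a" "\<lambda>x. x + bar m a"]) auto
  finally show ?thesis by (simp add: sum_psi)
qed

section \<open>The spectrum\<close>

definition conn_set :: "'a set" where
  "conn_set = {x. x \<noteq> 0 \<and> trace_F2 m (x + bar m x) = 1 \<and> trace_F2 m (x * bar m x) = 1}"

lemma conn_set_iff: "x \<in> conn_set \<longleftrightarrow> chi x = - 1 \<and> psi x = - 1"
proof -
  have "x \<noteq> 0" if "chi x = - 1" using that chi_0 by force
  moreover have "trace_F2 m (x + bar m x) = 1 \<longleftrightarrow> chi x = - 1"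
    by (rule trace_F2_cases[OF bar_add_bar[of x]]) (auto simp: chi_def sgn_F2_def)
  moreover have "trace_F2 m (x * bar m x) = 1 \<longleftrightarrow> psi x = - 1"
    by (rule trace_F2_cases[OF bar_mult_bar[of x]]) (auto simp: psi_def sgn_F2_def)
  ultimately show ?thesis by (auto simp: conn_set_def)
qed

text \<open>The Fourier coefficient at \<open>a\<close> of the indicator of \<open>conn_set\<close>,
  which is the eigenvalue belonging to the character \<open>x \<mapsto> chi (a * x)\<close>.\<close>

definition ev :: "'a \<Rightarrow> real" where
  "ev a = (\<Sum>d\<in>conn_set. chi (a * d))"

text \<open>Expanding the indicator and using \<open>chi x * chi (a * x) = chi ((a + 1) * x)\<close>
  leaves complete sums at \<open>a\<close> and \<open>a + 1\<close>. Orthogonality supplies the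
  point masses at 0 and 1, completing the square the rest.\<close>

lemma ev_eq:
  "4 * ev a = (if a = 0 then 2 ^ (2 * m) else 0) - (if a = 1 then 2 ^ (2 * m) else 0)
    + 2 ^ m * psi a * (1 - (- 1) ^ m * chi a)"
proof -
  have ind: "4 * (if x \<in> conn_set then t else 0) = (1 - chi x) * (1 - psi x) * t" for x t
    by (rule chi_cases[of x]; rule psi_cases[of x]) (simp_all add: conn_set_iff)
  have "4 * ev a = (\<Sum>x\<in>UNIV. 4 * (if x \<in> conn_set then chi (a * x) else 0))"
    by (simp add: ev_def sum.If_cases flip: sum_distrib_left)
  also have "\<dots> = (\<Sum>x\<in>UNIV. chi (a * x) - chi ((a + 1) * x)
      - psi x * chi (a * x) + psi x * chi ((a + 1) * x))"
    unfolding ind by (intro sum.cong) (auto simp: chi_add distrib_right algebra_simps)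
  also have "\<dots> = (\<Sum>x\<in>UNIV. chi (a * x)) - (\<Sum>x\<in>UNIV. chi ((a + 1) * x))
      - (\<Sum>x\<in>UNIV. psi x * chi (a * x)) + (\<Sum>x\<in>UNIV. psi x * chi ((a + 1) * x))"
    by (simp add: sum.distrib sum_subtractf)
  also have "a + 1 = 0 \<longleftrightarrow> a = 1"
    by (metis add_self add_right_cancel)
  then have "(\<Sum>x\<in>UNIV. chi ((a + 1) * x)) = (if a = 1 then 2 ^ (2 * m) else 0)"
    by (simp add: sum_chi_mult)
  also have "psi (a + 1) = psi a * (- 1) ^ m * chi a"
    by (simp add: psi_add psi_1 bar_1)
  then have "(\<Sum>x\<in>UNIV. psi x * chi ((a + 1) * x)) = - (2 ^ m) * (psi a * (- 1) ^ m * chi a)"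
    by (simp only: sum_psi_chi)
  finally show ?thesis
    by (simp only: sum_chi_mult sum_psi_chi) (simp add: algebra_simps)
qed

text \<open>The degree of the graph, that is, the eigenvalue of the trivial character.\<close>

definition lam :: real where
  "lam = (if even m then 2 ^ (2 * m - 2) else 2 ^ (2 * m - 2) + 2 ^ (m - 1))"

text \<open>Expressing everything through \<open>2 ^ (m - 1)\<close> removes the truncated
  subtractions from the later arithmetic.\<close>

lemma two_powers:
  "(2::real) ^ m = 2 * 2 ^ (m - 1)" "(2::real) ^ (2 * m) = 4 * (2 ^ (m - 1)) ^ 2"
  "(2::real) ^ (2 * m - 2) = (2 ^ (m - 1)) ^ 2"
  using m_pos by (cases m; simp add: power_mult[symmetric] power_add[symmetric] mult.commute)+

text \<open>Even \<open>m\<close> is at least 2, so the exponent \<open>2 * m - 2\<close> exceeds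
  \<open>m - 1\<close>; for odd \<open>m\<close> the extra summand gives strictness. This separates
  \<open>lam\<close> from the values at \<open>a\<close> outside 0 and 1.\<close>

lemma lam_greater: "2 ^ (m - 1) < lam"
proof (cases "even m")
  case True
  then have "m \<ge> 2" using m_pos by presburger
  then have "(2::real) ^ (m - 1) < 2 ^ (2 * m - 2)"
    by (intro power_strict_increasing) auto
  then show ?thesis using True by (simp add: lam_def)
qed (simp add: lam_def)

lemma lam_pos: "0 < lam"
  by (rule less_trans[OF _ lam_greater]) simp

lemma ev_0: "ev 0 = lam"
proof -
  have "psi 0 = 1" by (simp add: psi_def sgn_F2_def trace_0)
  then show ?thesis
    using ev_eq[of 0] by (cases "even m") (simp_all add: lam_def chi_0 two_powers)
qed

lemma ev_1: "ev 1 = - lam"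
  using ev_eq[of 1] by (cases "even m") (simp_all add: lam_def chi_1 psi_1 two_powers)

lemma ev_other:
  assumes "a \<noteq> 0" and "a \<noteq> 1"
  shows "ev a = (if chi a = (- 1) ^ m then 0 else 2 ^ (m - 1) * psi a)"
proof -
  have "4 * ev a = 2 ^ m * psi a * (1 - (- 1) ^ m * chi a)"
    using assms by (simp add: ev_eq)
  then show ?thesis
    by (cases rule: chi_cases[of a]; cases "even m") (auto simp: two_powers)
qed

lemma ev_neq_lam:
  assumes "a \<noteq> 0"
  shows "ev a \<noteq> lam"
proof (cases "a = 1")
  case True
  with lam_pos show ?thesis by (simp add: ev_1)
next
  case False
  have "ev a \<le> 2 ^ (m - 1)"
    using ev_other[OF assms False] by (cases rule: psi_cases[of a]) auto
  with lam_greater show ?thesis by simp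
qed

lemma card_conn_set: "real (card conn_set) = lam"
  using ev_0 by (simp add: ev_def chi_0)

section \<open>Which eigenvalues occur\<close>

lemma card_chi_eq:
  assumes "e = 1 \<or> e = - 1"
  shows "2 * real (card {x. chi x = e}) = 2 ^ (2 * m)"
proof -
  have "(\<Sum>x\<in>UNIV. chi x) = 0" using sum_chi_mult[of 1] by simp
  then have "2 ^ (2 * m) = (\<Sum>x\<in>UNIV. 1 + e * chi x)"
    by (simp add: sum.distrib card_field flip: sum_distrib_left)
  also have "\<dots> = (\<Sum>x\<in>UNIV. if chi x = e then 2 else 0)"
    using assms by (intro sum.cong refl) (metis (no_types, lifting) chi_cases add.right_inverse
        mult_1 mult_minus1 one_add_one minus_minus mult_minus_left)
  also have "\<dots> = 2 * real (card {x. chi x = e})"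
    by (simp add: sum.If_cases)
  finally show ?thesis by simp
qed

text \<open>The summand \<open>(1 - ?s * chi x) * (1 + e * psi x)\<close> is four times the
  indicator. The prescribed value of \<open>chi\<close> is the one at which \<open>ev_other\<close>
  does not vanish, and for it the sums of \<open>psi\<close> and \<open>psi * chi\<close>
  cancel.\<close>

lemma card_chi_psi_eq:
  assumes "e = 1 \<or> e = - 1"
  shows "4 * real (card {x. chi x = - ((- 1) ^ m) \<and> psi x = e}) = 2 ^ (2 * m)"
proof -
  let ?s = "(- 1) ^ m :: real"
  have sums: "(\<Sum>x\<in>UNIV. chi x) = 0" "(\<Sum>x\<in>UNIV. psi x * chi x) = - (2 ^ m) * ?s"
    using sum_chi_mult[of 1] sum_psi_chi[of 1] by (simp_all add: psi_1)
  have s: "?s * ?s = 1" by (simp flip: power_mult_distrib)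
  have "(\<Sum>x\<in>UNIV. (1 - ?s * chi x) * (1 + e * psi x))
      = (\<Sum>x\<in>UNIV. 1 - ?s * chi x + e * psi x - e * ?s * (psi x * chi x))"
    by (intro sum.cong) (simp_all add: algebra_simps)
  also have "\<dots> = 2 ^ (2 * m)"
    using s by (simp add: sum.distrib sum_subtractf card_field sums sum_psi flip: sum_distrib_left)
  finally have "2 ^ (2 * m) = (\<Sum>x\<in>UNIV. (1 - ?s * chi x) * (1 + e * psi x))" by simp
  also have "\<dots> = (\<Sum>x\<in>UNIV. if chi x = - ?s \<and> psi x = e then 4 else 0)"
  proof (intro sum.cong refl)
    fix x
    show "(1 - ?s * chi x) * (1 + e * psi x) = (if chi x = - ?s \<and> psi x = e then 4 else 0)"
      using assms
      by (cases rule: chi_cases[of x]; cases rule: psi_cases[of x]; cases "even m") auto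
  qed
  also have "\<dots> = 4 * real (card {x. chi x = - ?s \<and> psi x = e})"
    by (simp add: sum.If_cases)
  finally show ?thesis by simp
qed

lemma exists_other:
  assumes "card (S::'a set) > 2"
  obtains a where "a \<in> S" "a \<noteq> 0" "a \<noteq> 1"
proof -
  have "\<not> S \<subseteq> {0, 1}"
  proof
    assume "S \<subseteq> {0, 1}"
    then have "card S \<le> card {0, 1::'a}" by (intro card_mono) auto
    with assms show False by simp
  qed
  then show ?thesis using that by blast
qed

text \<open>For odd \<open>m\<close> the condition \<open>chi a = - 1\<close> already excludes 0 and
  1; for even \<open>m\<close> half of at least 16 elements satisfy
  \<open>chi a = 1\<close>.\<close>

lemma zero_in_range_ev: "0 \<in> range ev"
proof -
  obtain a where a: "chi a = (- 1) ^ m" "a \<noteq> 0" "a \<noteq> 1"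
  proof (cases "even m")
    case False
    obtain a where "chi a = - 1" by (rule chi_nontrivial)
    with False chi_0 chi_1 show ?thesis by (intro that[of a]) auto
  next
    case True
    then have "m \<ge> 2" using m_pos by presburger
    then have "(2::real) ^ 4 \<le> 2 ^ (2 * m)" by (intro power_increasing) auto
    then have "card {x. chi x = 1} > 2"
      using card_chi_eq[of 1] by simp
    then obtain a where "a \<in> {x. chi x = 1}" "a \<noteq> 0" "a \<noteq> 1"
      by (rule exists_other)
    with True show ?thesis by (intro that[of a]) auto
  qed
  then have "ev a = 0" by (simp add: ev_other)
  then show ?thesis by (metis rangeI)
qed

lemma range_ev_subset: "range ev \<subseteq> {lam, - lam, 0, 2 ^ (m - 1), - (2 ^ (m - 1))}"
proof
  fix l assume "l \<in> range ev"
  then obtain a where l: "l = ev a" by blast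
  show "l \<in> {lam, - lam, 0, 2 ^ (m - 1), - (2 ^ (m - 1))}"
    by (cases "a = 0"; cases "a = 1"; rule psi_cases[of a])
       (auto simp: l ev_0 ev_1 ev_other)
qed

lemma range_ev:
  assumes "m \<ge> 2"
  shows "range ev = {lam, - lam, 0, 2 ^ (m - 1), - (2 ^ (m - 1))}"
proof
  have "e * 2 ^ (m - 1) \<in> range ev" if e: "e = 1 \<or> e = - 1" for e
  proof -
    \<comment> \<open>A quarter of at least 16 elements is at least 4, so some \<open>a\<close>
      avoids both 0 and 1.\<close>
    have "(2::real) ^ 4 \<le> 2 ^ (2 * m)" using assms by (intro power_increasing) auto
    then have "card {x. chi x = - ((- 1) ^ m) \<and> psi x = e} > 2"
      using card_chi_psi_eq[OF e] by simp
    then obtain a where "a \<in> {x. chi x = - ((- 1) ^ m) \<and> psi x = e}" "a \<noteq> 0" "a \<noteq> 1"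
      by (rule exists_other)
    then have "ev a = e * 2 ^ (m - 1)" by (simp add: ev_other)
    then show ?thesis by (metis rangeI)
  qed
  from this[of 1] this[of "- 1"]
  show "{lam, - lam, 0, 2 ^ (m - 1), - (2 ^ (m - 1))} \<subseteq> range ev"
    using zero_in_range_ev rangeI[of ev 0] rangeI[of ev 1] by (simp add: ev_0 ev_1)
qed (rule range_ev_subset)

text \<open>Over four elements the graph is a 4-cycle: \<open>chi\<close> is 1 only at 0 and 1, so
  the two remaining characters both give eigenvalue 0.\<close>

lemma range_ev_m_1:
  assumes "m = 1"
  shows "range ev = {lam, - lam, 0}"
proof
  have "2 = card {x. chi x = 1}"
    using card_chi_eq[of 1] assms by simp
  then have "{0, 1} = {x. chi x = 1}"
    by (intro card_subset_eq) (auto simp: chi_0 chi_1)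
  then have "chi a = - 1" if "a \<noteq> 0" "a \<noteq> 1" for a
    using that by (cases rule: chi_cases[of a]) auto
  moreover have "(- 1) ^ m = (- 1 :: real)" using assms by simp
  ultimately have "ev a \<in> {lam, - lam, 0}" for a
    by (cases "a = 0"; cases "a = 1") (auto simp: ev_0 ev_1 ev_other)
  then show "range ev \<subseteq> {lam, - lam, 0}" by blast
  show "{lam, - lam, 0} \<subseteq> range ev"
    using zero_in_range_ev rangeI[of ev 0] rangeI[of ev 1] by (simp add: ev_0 ev_1)
qed

section \<open>Fourier analysis and the spectrum\<close>

lemma Fourier_inversion:
  "(\<Sum>a\<in>UNIV. chi (a * y) * (\<Sum>x\<in>UNIV. v x * chi (a * x))) = 2 ^ (2 * m) * v y"
proof -
  have "chi (a * y) * (v x * chi (a * x)) = v x * chi ((y + x) * a)" for a x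
    by (simp add: distrib_right chi_add mult.commute[of a] mult.left_commute)
  then have "(\<Sum>a\<in>UNIV. chi (a * y) * (\<Sum>x\<in>UNIV. v x * chi (a * x)))
      = (\<Sum>a\<in>UNIV. \<Sum>x\<in>UNIV. v x * chi ((y + x) * a))"
    by (simp only: sum_distrib_left)
  also have "\<dots> = (\<Sum>x\<in>UNIV. v x * (\<Sum>a\<in>UNIV. chi ((y + x) * a)))"
    by (subst sum.swap) (simp add: sum_distrib_left)
  also have "\<dots> = (\<Sum>x\<in>UNIV. if x = y then v x * 2 ^ (2 * m) else 0)"
    by (intro sum.cong) (auto simp: sum_chi_mult add_eq_0_iff uminus_eq)
  finally show ?thesis by simp
qed

text \<open>The transform turns convolution with the indicator into multiplication by
  \<open>ev\<close>. So the transform of an eigenfunction for \<open>l\<close> is supported where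
  \<open>ev a = l\<close>.\<close>

lemma Fourier_convolution:
  assumes "\<And>x. (\<Sum>d\<in>conn_set. v (x - d)) = l * v x"
  shows "ev a * (\<Sum>x\<in>UNIV. v x * chi (a * x)) = l * (\<Sum>x\<in>UNIV. v x * chi (a * x))"
proof -
  have shift: "(\<Sum>x\<in>UNIV. v (x - d) * chi (a * x)) = (\<Sum>x\<in>UNIV. v x * chi (a * x)) * chi (a * d)" for d
  proof -
    have "(\<Sum>x\<in>UNIV. v (x - d) * chi (a * x)) = (\<Sum>x\<in>UNIV. v x * chi (a * (x + d)))"
      by (rule sum.reindex_bij_witness[of _ "\<lambda>x. x + d" "\<lambda>x. x - d"]) auto
    then show ?thesis
      by (simp add: distrib_left chi_add sum_distrib_right mult.assoc)
  qed
  have "l * (\<Sum>x\<in>UNIV. v x * chi (a * x)) = (\<Sum>x\<in>UNIV. (\<Sum>d\<in>conn_set. v (x - d)) * chi (a * x))"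
    by (simp add: assms sum_distrib_left mult.assoc)
  also have "\<dots> = (\<Sum>d\<in>conn_set. \<Sum>x\<in>UNIV. v (x - d) * chi (a * x))"
    by (simp add: sum_distrib_right) (rule sum.swap)
  also have "\<dots> = ev a * (\<Sum>x\<in>UNIV. v x * chi (a * x))"
    by (simp only: shift ev_def sum_distrib_left[symmetric]) (rule mult.commute)
  finally show ?thesis by (rule sym)
qed

text \<open>For \<open>l\<close> outside the range the transform of an eigenfunction would vanish
  everywhere, contradicting inversion. Conversely, the characters themselves are
  eigenfunctions.\<close>

lemma graph_eigenvalues_conn_set: "graph_eigenvalues (cayley_graph conn_set) = range ev"
proof (intro subset_antisym subsetI)
  fix l assume "l \<in> graph_eigenvalues (cayley_graph conn_set)"
  then obtain v y where v: "v y \<noteq> 0" "\<And>x. (\<Sum>d\<in>conn_set. v (x - d)) = l * v x"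
    unfolding graph_eigenvalues_cayley_graph by blast
  show "l \<in> range ev"
  proof (rule ccontr)
    assume "l \<notin> range ev"
    then have "(\<Sum>x\<in>UNIV. v x * chi (a * x)) = 0" for a
      using Fourier_convolution[OF v(2), of a] by auto
    then have "2 ^ (2 * m) * v y = 0"
      using Fourier_inversion[of y v] by simp
    with v(1) show False by simp
  qed
next
  fix l assume "l \<in> range ev"
  then obtain a where a: "l = ev a" by blast
  have "chi (a * (x - d)) = chi (a * d) * chi (a * x)" for x d
    by (simp add: minus_eq_plus distrib_left chi_add)
  then have "(\<Sum>d\<in>conn_set. chi (a * (x - d))) = l * chi (a * x)" for x
    by (simp add: a ev_def sum_distrib_right)
  moreover have "chi (a * 0) \<noteq> 0" by (simp add: chi_0)
  ultimately show "l \<in> graph_eigenvalues (cayley_graph conn_set)"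
    unfolding graph_eigenvalues_cayley_graph by (intro exI[of _ "\<lambda>x. chi (a * x)"]) blast
qed

section \<open>Connectedness, bipartition and the Ramanujan bound\<close>

lemma conn_set_symmetric: "0 \<notin> conn_set" "d \<in> conn_set \<Longrightarrow> - d \<in> conn_set"
  by (simp_all add: conn_set_def uminus_eq)

text \<open>Only \<open>a = 0\<close> has \<open>ev a = lam\<close>, so the transform of an
  eigenfunction for the degree lives at 0, and inversion makes the function constant.\<close>

lemma connected_conn_set: "Digraph_Component.connected (with_proj (cayley_graph conn_set))"
proof (rule connected_cayley_graphI[OF conn_set_symmetric])
  fix v :: "'a \<Rightarrow> real" and x y
  assume "\<And>x. (\<Sum>d\<in>conn_set. v (x - d)) = card conn_set * v x"
  then have v: "(\<Sum>d\<in>conn_set. v (x - d)) = lam * v x" for x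
    by (simp add: card_conn_set)
  have zero: "(\<Sum>x\<in>UNIV. v x * chi (a * x)) = 0" if "a \<noteq> 0" for a
    using Fourier_convolution[OF v, of a] ev_neq_lam[OF that] by simp
  have "2 ^ (2 * m) * v y = (\<Sum>a\<in>(UNIV :: 'a set). if a = 0 then \<Sum>x\<in>UNIV. v x else 0)" for y
    unfolding Fourier_inversion[symmetric] by (intro sum.cong) (auto simp: chi_0 zero)
  then have "2 ^ (2 * m) * v x = 2 ^ (2 * m) * v y" by simp
  then show "v x = v y" by simp
qed

lemma bipartite_conn_set: "bipartite (cayley_graph conn_set)"
  unfolding bipartite_def
proof (intro exI conjI ballI)
  show "{x. chi x = 1} \<union> {x. chi x = - 1} = pverts (cayley_graph conn_set)"
    using chi_cases by (auto simp: cayley_graph_def)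
  show "{x. chi x = 1} \<inter> {x. chi x = - 1} = {}" by auto
  show "case e of (u, v) \<Rightarrow> u \<in> {x. chi x = 1} \<and> v \<in> {x. chi x = - 1} \<or>
      u \<in> {x. chi x = - 1} \<and> v \<in> {x. chi x = 1}"
    if "e \<in> parcs (cayley_graph conn_set)" for e
  proof -
    obtain u v where e: "e = (u, v)" by force
    with that have "chi u * chi v = - 1"
      by (simp add: cayley_graph_def conn_set_iff minus_eq_plus chi_add)
    then show ?thesis
      unfolding e by (cases rule: chi_cases[of u]; cases rule: chi_cases[of v]) auto
  qed
qed

lemma ramanujan_conn_set: "ramanujan_graph (cayley_graph conn_set)"
proof -
  have "l \<le> 2 * sqrt (lam - 1)" if l: "l \<in> range ev" "\<bar>l\<bar> \<noteq> lam" for l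
  proof -
    let ?p = "2 ^ (m - 1) :: real"
    have "\<bar>lam\<bar> = lam" using lam_pos by simp
    then have "l \<le> ?p"
      using range_ev_subset l by auto
    \<comment> \<open>For \<open>m \<ge> 2\<close> this follows from
      \<open>4 \<le> ?p\<^sup>2\<close> and \<open>?p\<^sup>2 \<le> lam\<close>; for
      \<open>m = 1\<close> it reads \<open>1 \<le> 4\<close>.\<close>
    moreover have "?p\<^sup>2 \<le> 4 * (lam - 1)"
    proof (cases "m = 1")
      case False
      with m_pos have "(2::real) ^ 1 \<le> ?p" by (intro power_increasing) auto
      then have "2\<^sup>2 \<le> ?p\<^sup>2" by (intro power_mono) auto
      moreover have "?p\<^sup>2 \<le> lam" by (simp add: lam_def two_powers)
      ultimately show ?thesis by simp
    next
      case True
      then have "lam = 2" unfolding lam_def by simp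
      with True show ?thesis by simp
    qed
    then have "?p \<le> sqrt (4 * (lam - 1))" by (rule real_le_rsqrt)
    then have "?p \<le> 2 * sqrt (lam - 1)" by (simp only: real_sqrt_mult real_sqrt_four)
    ultimately show ?thesis by (rule order_trans)
  qed
  then have "\<forall>l\<in>graph_eigenvalues (cayley_graph conn_set).
      \<bar>l\<bar> \<noteq> real (card conn_set) \<longrightarrow> l \<le> 2 * sqrt (real (card conn_set) - 1)"
    by (simp only: graph_eigenvalues_conn_set card_conn_set) blast
  then show ?thesis
    unfolding ramanujan_graph_def
    using pair_graph_cayley_graph[OF conn_set_symmetric] connected_conn_set
      regular_graph_cayley_graph by blast
qed

end

theorem theorem4p5:
  fixes m n :: nat
    and D :: "'a::{field,finite} set"
    and G :: "'a pair_pre_digraph"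
    and lam :: real
  assumes "m > 0"
    and "n = 2 * m"
    and "CARD('a) = 2 ^ n"
    and "D = {x. x \<noteq> 0 \<and> trace_F2 m (x + bar m x) = 1 \<and> trace_F2 m (x * bar m x) = 1}"
    and "G = cayley_graph D"
    and "lam = (if even m then 2 ^ (n - 2) else 2 ^ (n - 2) + 2 ^ (m - 1))"
  shows "pair_graph G \<and> Digraph_Component.connected (with_proj G) \<and> bipartite G \<and>
    (m \<ge> 2 \<longrightarrow>
       graph_eigenvalues G = {lam, - lam, 0, 2 ^ (m - 1), - (2 ^ (m - 1))} \<and>
       card (graph_eigenvalues G) = 5) \<and>
    (m = 1 \<longrightarrow> graph_eigenvalues G = {lam, - lam, 0}) \<and>
    ramanujan_graph G"
proof -
  interpret F: quadratic_field_F2 m "TYPE('a)"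
    using assms by unfold_locales auto
  have G: "G = cayley_graph F.conn_set"
    using assms by (simp add: F.conn_set_def)
  have lam: "lam = F.lam"
    using assms by (simp add: F.lam_def)
  \<comment> \<open>The chain \<open>0 < 2 ^ (m - 1) < lam\<close> makes the five listed values
    distinct.\<close>
  have p: "0 < (2::real) ^ (m - 1)" by simp
  then have "F.lam \<noteq> - (2 ^ (m - 1))" using F.lam_pos by linarith
  then have "card {lam, - lam, 0, 2 ^ (m - 1), - (2 ^ (m - 1))} = 5"
    using F.lam_greater F.lam_pos p unfolding lam by (simp add: card_insert_if)
  then show ?thesis
    unfolding G F.graph_eigenvalues_conn_set
    using F.range_ev F.range_ev_m_1 F.connected_conn_set F.bipartite_conn_set F.ramanujan_conn_set
      pair_graph_cayley_graph[OF F.conn_set_symmetric] lam by simp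
qed

end
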